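(* Training a 3D scene representation with the Score Distillation Sampling (SDS) generative prior is mathematically equivalent (up to scale) to using L2 reconstruction loss against images generated from the 2D generator.
   Context: A 3D scene representation (for example a NeRF or a set of 3D Gaussians) has parameters $\theta$. Rendering it differentiably from a viewpoint $\pi$ gives an image $x=g(\theta,\pi)$. Training proceeds iteratively: random viewpoints $\pi$ are sampled, the scene is rendered, and $\theta$ is updated by a gradient. The 2D generator is a pretrained 2D diffusion model conditioned on a text prompt $y$. For a noise level $t$, a fixed variance schedule gives $\bar\alpha_t$, and the rendering is perturbed by Gaussian noise $\epsilon\sim\mathcal{N}(0,1)$ to $$x_t=\sqrt{\bar\alpha_t}\,x+\sqrt{1-\bar\alpha_t}\,\epsilon .$$ The diffusion network predicts the added noise, $\hat\epsilon(x_t;t,y)$, which yields a one-step prediction of the denoised image $$\hat x(x_t;t,y)=\frac{x_t-\sqrt{1-\bar\alpha_t}\,\hat\epsilon(x_t;t,y)}{\sqrt{\bar\alpha_t}} .$$ This is the image generated by the 2D generator from the current rendering. Training with the SDS generative prior means updating $\theta$ with the SDS loss gradient, which is defined (omitting the Jacobian of the diffusion network) by $$\nabla_\theta \ell_{\mathrm{SDS}}(x=g(\theta,\pi)) := \mathbb{E}_{t,\epsilon}\Big[w_t\big(\hat\epsilon(x_t;y,t)-\epsilon\big)\frac{\partial x}{\partial\theta}\Big],$$ where $w_t$ (also written $w(t)$) is a scalar weight depending on $t$. Using L2 reconstruction loss against generated images means the usual supervised reconstruction framework: the current rendering $x$ is compared in squared L2 distance with a ground truth image, the role of ground truth being played by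 the generated image. "Equivalent up to scale" refers to the training gradients: the SDS gradient is the gradient of an L2 loss scaled by a factor depending on $t$. The diffusion model may be an image-space model (noise is applied directly to the image, as in the formulas above) or a latent-space model (an encoder maps images to a latent space and noise is applied only there); for a latent-space model the L2 loss in question is a latent-space L2 loss. *)

theory Defs
  imports "HOL-Probability.Probability"
begin

text \<open>The law $\mathcal{N}(0, I)$: the coordinates with respect to the orthonormal basis are
  independent standard normal variables.\<close>

definition std_gaussian :: "'a::euclidean_space measure" where
  "std_gaussian =
     distr (\<Pi>\<^sub>M b\<in>Basis. density lborel (\<lambda>u. ennreal (std_normal_density u))) borel
       (\<lambda>f. \<Sum>b\<in>Basis. f b *\<^sub>R b)"

lemma prob_space_std_gaussian: "prob_space (std_gaussian :: 'a::euclidean_space measure)"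
proof -
  interpret N: prob_space "density lborel (\<lambda>u. ennreal (std_normal_density u))"
    by (rule prob_space_normal_density) simp
  interpret P: product_prob_space
      "\<lambda>_::'a. density lborel (\<lambda>u. ennreal (std_normal_density u))" Basis
    by standard
  show ?thesis
    unfolding std_gaussian_def by (rule P.prob_space_distr) measurable
qed

text \<open>A diffusion model conditioned on prompts of type \<^typ>\<open>'y\<close>, operating on a Euclidean space
  \<^typ>\<open>'z\<close> (images, or latents for a latent-space model). The noise levels form an arbitrary
  probability space, so that both discrete and continuous time are covered. No regularity of the
  network is required.\<close>

record ('t, 'y, 'z) diffusion_model =
  level_dist :: "'t measure"
  alpha_bar :: "'t \<Rightarrow> real"
  noise_pred :: "'z \<Rightarrow> 't \<Rightarrow> 'y \<Rightarrow> 'z"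

definition diffusion_model_wf :: "('t, 'y, 'z) diffusion_model \<Rightarrow> bool" where
  "diffusion_model_wf D \<longleftrightarrow>
     prob_space (level_dist D) \<and> (\<forall>t\<in>space (level_dist D). 0 < alpha_bar D t \<and> alpha_bar D t < 1)"

definition perturbed ::
  "('t, 'y, 'z::euclidean_space) diffusion_model \<Rightarrow> 'z \<Rightarrow> 't \<Rightarrow> 'z \<Rightarrow> 'z" where
  "perturbed D x t \<epsilon> = sqrt (alpha_bar D t) *\<^sub>R x + sqrt (1 - alpha_bar D t) *\<^sub>R \<epsilon>"

definition denoised ::
  "('t, 'y, 'z::euclidean_space) diffusion_model \<Rightarrow> 'y \<Rightarrow> 'z \<Rightarrow> 't \<Rightarrow> 'z" where
  "denoised D y x\<^sub>t t =
     (x\<^sub>t - sqrt (1 - alpha_bar D t) *\<^sub>R noise_pred D x\<^sub>t t y) /\<^sub>R sqrt (alpha_bar D t)"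

definition generated ::
  "('t, 'y, 'z::euclidean_space) diffusion_model \<Rightarrow> 'y \<Rightarrow> 'z \<Rightarrow> 't \<Rightarrow> 'z \<Rightarrow> 'z" where
  "generated D y x t \<epsilon> = denoised D y (perturbed D x t \<epsilon>) t"

definition noise_measure ::
  "('t, 'y, 'z::euclidean_space) diffusion_model \<Rightarrow> ('t \<times> 'z) measure" where
  "noise_measure D = level_dist D \<Otimes>\<^sub>M std_gaussian"

text \<open>The function \<open>f\<close> below maps parameters to the space in which noise is applied: it is
  $\theta \mapsto g(\theta, \pi)$ for an image-space model and $\theta \mapsto E(g(\theta, \pi))$,
  with $E$ the encoder, for a latent-space model. The product of the row vector
  $\hat\epsilon - \epsilon$ with the Jacobian of \<open>f\<close>, read as a vector of parameters, is the
  adjoint of the derivative applied to $\hat\epsilon - \epsilon$.\<close>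

definition sds_sample_gradient ::
  "('t, 'y, 'z::euclidean_space) diffusion_model \<Rightarrow> ('t \<Rightarrow> real) \<Rightarrow> 'y
     \<Rightarrow> ('p::euclidean_space \<Rightarrow> 'z) \<Rightarrow> 'p \<Rightarrow> 't \<Rightarrow> 'z \<Rightarrow> 'p" where
  "sds_sample_gradient D w y f \<theta> t \<epsilon> =
     w t *\<^sub>R adjoint (frechet_derivative f (at \<theta>))
              (noise_pred D (perturbed D (f \<theta>) t \<epsilon>) t y - \<epsilon>)"

definition sds_gradient ::
  "('t, 'y, 'z::euclidean_space) diffusion_model \<Rightarrow> ('t \<Rightarrow> real) \<Rightarrow> 'y
     \<Rightarrow> ('p::euclidean_space \<Rightarrow> 'z) \<Rightarrow> 'p \<Rightarrow> 'p" where
  "sds_gradient D w y f \<theta> =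
     (\<integral>(t, \<epsilon>). sds_sample_gradient D w y f \<theta> t \<epsilon> \<partial>noise_measure D)"

definition l2_loss :: "'z::real_normed_vector \<Rightarrow> 'z \<Rightarrow> real" where
  "l2_loss x target = (norm (x - target))\<^sup>2"

definition gradient :: "('p::real_inner \<Rightarrow> real) \<Rightarrow> 'p \<Rightarrow> 'p" where
  "gradient F \<theta> = (THE G. GDERIV F \<theta> :> G)"

text \<open>The training gradient of L2 reconstruction against generated images, with weight \<open>s t\<close> at
  noise level \<open>t\<close>. The generated image is a fixed ground truth: it is computed from the current
  rendering \<open>f \<theta>\<close>, and only the first argument of the loss is differentiated.\<close>

definition l2_gradient ::
  "('t, 'y, 'z::euclidean_space) diffusion_model \<Rightarrow> ('t \<Rightarrow> real) \<Rightarrow> 'y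
     \<Rightarrow> ('p::euclidean_space \<Rightarrow> 'z) \<Rightarrow> 'p \<Rightarrow> 'p" where
  "l2_gradient D s y f \<theta> =
     (\<integral>(t, \<epsilon>). s t *\<^sub>R gradient (\<lambda>\<theta>'. l2_loss (f \<theta>') (generated D y (f \<theta>) t \<epsilon>)) \<theta>
        \<partial>noise_measure D)"

definition sds_scale :: "('t, 'y, 'z) diffusion_model \<Rightarrow> ('t \<Rightarrow> real) \<Rightarrow> 't \<Rightarrow> real" where
  "sds_scale D w t = w t * sqrt (alpha_bar D t) / (2 * sqrt (1 - alpha_bar D t))"

text \<open>The expected loss, as a function of a candidate \<open>x\<close>, when the targets are generated from
  the rendering \<open>x\<^sub>0\<close>.\<close>

definition expected_l2_loss ::
  "('t, 'y, 'z::euclidean_space) diffusion_model \<Rightarrow> ('t \<Rightarrow> real) \<Rightarrow> 'y \<Rightarrow> 'z \<Rightarrow> 'z \<Rightarrow> real" where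
  "expected_l2_loss D s y x\<^sub>0 x =
     (\<integral>(t, \<epsilon>). s t * l2_loss x (generated D y x\<^sub>0 t \<epsilon>) \<partial>noise_measure D)"

definition finite_expected_l2_loss ::
  "('t, 'y, 'z::euclidean_space) diffusion_model \<Rightarrow> ('t \<Rightarrow> real) \<Rightarrow> 'y \<Rightarrow> 'z \<Rightarrow> bool" where
  "finite_expected_l2_loss D s y x\<^sub>0 \<longleftrightarrow>
     (\<forall>x. integrable (noise_measure D) (\<lambda>(t, \<epsilon>). s t * l2_loss x (generated D y x\<^sub>0 t \<epsilon>)))"

end

theory Submission imports Defs begin

text \<open>The displacement between a rendering and the image generated from it is
  $x - \hat x = \sqrt{1 - \bar\alpha_t} / \sqrt{\bar\alpha_t} \, (\hat\epsilon - \epsilon)$, so the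
  SDS residual is $2 s_t (x - \hat x)$ for the scale
  $s_t = w_t \sqrt{\bar\alpha_t} / (2 \sqrt{1 - \bar\alpha_t})$, and the adjoint of the Jacobian
  maps this to the gradient of the scaled squared distance to the fixed target $\hat x$. The expected
  loss is a quadratic polynomial in the candidate, so it can be differentiated without a dominated
  convergence argument: finiteness at every candidate already forces its coefficients to be
  integrable.\<close>

lemma GDERIV_unique:
  assumes "GDERIV F x :> G" "GDERIV F x :> H"
  shows "G = H"
proof -
  have "(\<lambda>h. h \<bullet> G) = (\<lambda>h. h \<bullet> H)"
    using assms unfolding gderiv_def by (rule has_derivative_unique)
  then show ?thesis
    by (simp add: fun_eq_iff vector_eq_ldot)
qed

lemma gradient_eqI: "GDERIV F x :> G \<Longrightarrow> gradient F x = G"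
  unfolding gradient_def by (blast intro: the_equality GDERIV_unique)

text \<open>By the chain rule the derivative in direction \<open>h\<close> is the inner product of
  \<open>frechet_derivative f (at \<theta>) h\<close> with \<open>G\<close>. Moving the derivative
  across the inner product as its adjoint produces the Jacobian factor found in the SDS
  gradient.\<close>

lemma GDERIV_compose_adjoint:
  fixes f :: "'p::euclidean_space \<Rightarrow> 'z::euclidean_space"
  assumes "f differentiable at \<theta>" "GDERIV F (f \<theta>) :> G"
  shows "GDERIV (\<lambda>\<theta>'. F (f \<theta>')) \<theta> :> adjoint (frechet_derivative f (at \<theta>)) G"
proof -
  have f': "(f has_derivative frechet_derivative f (at \<theta>)) (at \<theta>)"
    using assms(1) frechet_derivative_works by blast
  have "linear (frechet_derivative f (at \<theta>))"
    using f' has_derivative_linear by blast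
  moreover have "((\<lambda>\<theta>'. F (f \<theta>')) has_derivative (\<lambda>h. frechet_derivative f (at \<theta>) h \<bullet> G)) (at \<theta>)"
    using has_derivative_compose[OF f'] assms(2) unfolding gderiv_def by blast
  ultimately show ?thesis
    unfolding gderiv_def by (simp add: adjoint_works)
qed

lemma GDERIV_norm_power2_diff: "GDERIV (\<lambda>x. (norm (x - c))\<^sup>2) x :> 2 *\<^sub>R (x - c)"
  unfolding gderiv_def power2_norm_eq_inner
  by (auto intro!: derivative_eq_intros simp: inner_commute)

text \<open>The target \<open>z\<close> does not vary with the parameters. Later it is the image
  generated from the rendering at the base point, which is how no derivative of the diffusion
  network arises.\<close>

lemma GDERIV_l2_loss:
  fixes f :: "'p::euclidean_space \<Rightarrow> 'z::euclidean_space"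
  assumes "f differentiable at \<theta>"
  shows "GDERIV (\<lambda>\<theta>'. c * l2_loss (f \<theta>') z) \<theta>
    :> adjoint (frechet_derivative f (at \<theta>)) ((2 * c) *\<^sub>R (f \<theta> - z))"
proof -
  have "GDERIV (\<lambda>x. c * l2_loss x z) (f \<theta>) :> (2 * c) *\<^sub>R (f \<theta> - z)"
    using has_derivative_mult_right[OF GDERIV_norm_power2_diff[unfolded gderiv_def]]
    unfolding gderiv_def l2_loss_def by (simp add: mult.assoc mult.left_commute)
  from GDERIV_compose_adjoint[OF assms this] show ?thesis .
qed

lemma diff_generated:
  assumes "0 < alpha_bar D t"
  shows "x - generated D y x t \<epsilon> = (sqrt (1 - alpha_bar D t) / sqrt (alpha_bar D t)) *\<^sub>R
    (noise_pred D (perturbed D x t \<epsilon>) t y - \<epsilon>)"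
proof -
  define n where "n = noise_pred D (perturbed D x t \<epsilon>) t y"
  have "generated D y x t \<epsilon> = (perturbed D x t \<epsilon> - sqrt (1 - alpha_bar D t) *\<^sub>R n)
      /\<^sub>R sqrt (alpha_bar D t)"
    by (simp only: generated_def denoised_def n_def)
  \<comment> \<open>Positivity of \<open>alpha_bar D t\<close> lets its root cancel in front of
    \<open>x\<close>; the injected and the predicted noise keep the common factor.\<close>
  also have "\<dots> = x - (sqrt (1 - alpha_bar D t) / sqrt (alpha_bar D t)) *\<^sub>R (n - \<epsilon>)"
    using assms
    by (simp add: perturbed_def scaleR_diff_right scaleR_add_right divide_inverse mult.commute)
  finally show ?thesis
    by (simp add: n_def)
qed

text \<open>\<open>sds_scale\<close> inverts the displacement factor of
  \<open>diff_generated\<close>, and its denominator 2 offsets the 2 from differentiating a square.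
  The strict bounds make both roots nonzero, so they cancel.\<close>

lemma sds_residual:
  assumes "0 < alpha_bar D t" "alpha_bar D t < 1"
  shows "w t *\<^sub>R (noise_pred D (perturbed D x t \<epsilon>) t y - \<epsilon>)
    = (2 * sds_scale D w t) *\<^sub>R (x - generated D y x t \<epsilon>)"
  using assms by (simp add: diff_generated sds_scale_def)

lemma sds_sample_gradient_eq:
  fixes f :: "'p::euclidean_space \<Rightarrow> 'z::euclidean_space"
  assumes "f differentiable at \<theta>" "0 < alpha_bar D t" "alpha_bar D t < 1"
  shows "sds_sample_gradient D w y f \<theta> t \<epsilon> = adjoint (frechet_derivative f (at \<theta>))
    ((2 * sds_scale D w t) *\<^sub>R (f \<theta> - generated D y (f \<theta>) t \<epsilon>))"
proof -
  have "linear (adjoint (frechet_derivative f (at \<theta>)))"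
    using assms(1) by (intro adjoint_linear linear_frechet_derivative)
  then show ?thesis
    by (simp only: sds_sample_gradient_def linear_scale flip: sds_residual[OF assms(2,3)])
qed

text \<open>A vector is the finite sum of its coordinates along \<open>Basis\<close>, so
  integrability can be tested by inner products.\<close>

lemma integrable_inner_euclideanI:
  fixes F :: "'a \<Rightarrow> 'z::euclidean_space"
  assumes "\<And>d. integrable M (\<lambda>\<omega>. F \<omega> \<bullet> d)"
  shows "integrable M F"
proof -
  have "integrable M (\<lambda>\<omega>. \<Sum>b\<in>Basis. (F \<omega> \<bullet> b) *\<^sub>R b)"
    by (intro Bochner_Integration.integrable_sum integrable_scaleR_left assms)
  then show ?thesis
    by (simp add: euclidean_representation)
qed

lemma norm_power2_diff_expand:
  fixes x x\<^sub>0 u :: "'z::real_inner"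
  shows "(norm (x - u))\<^sup>2
    = (norm (x - x\<^sub>0))\<^sup>2 + 2 * ((x\<^sub>0 - u) \<bullet> (x - x\<^sub>0)) + (norm (x\<^sub>0 - u))\<^sup>2"
  by (simp add: power2_norm_eq_inner algebra_simps inner_commute)

lemma integral_add3:
  fixes F G H :: "'a \<Rightarrow> 'z::{banach, second_countable_topology}"
  assumes "integrable M F" "integrable M G" "integrable M H"
  shows "(\<integral>\<omega>. F \<omega> + G \<omega> + H \<omega> \<partial>M)
    = (\<integral>\<omega>. F \<omega> \<partial>M) + (\<integral>\<omega>. G \<omega> \<partial>M) + (\<integral>\<omega>. H \<omega> \<partial>M)"
  using assms by simp

text \<open>The weight \<open>s\<close> may change sign, so no domination by the loss is available.
  Measurability and integrability of the coefficients are both extracted by taking linear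
  combinations of the loss at several candidates.\<close>

context
  fixes M :: "'a measure" and s :: "'a \<Rightarrow> real" and T :: "'a \<Rightarrow> 'z::euclidean_space"
  assumes finite_loss: "\<And>x. integrable M (\<lambda>\<omega>. s \<omega> * (norm (x - T \<omega>))\<^sup>2)"
begin

lemma integrable_weight: "integrable M s"
proof -
  obtain b :: 'z where b: "b \<in> Basis"
    using nonempty_Basis by blast
  \<comment> \<open>The second difference of the loss along a unit vector is the constant 2.\<close>
  have "integrable M (\<lambda>\<omega>. (s \<omega> * (norm (b - T \<omega>))\<^sup>2 + s \<omega> * (norm (- b - T \<omega>))\<^sup>2
      - 2 * (s \<omega> * (norm (0 - T \<omega>))\<^sup>2)) / 2)"
    by (intro integrable_divide Bochner_Integration.integrable_diff
        Bochner_Integration.integrable_add integrable_mult_right finite_loss)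
  also have "(\<lambda>\<omega>. (s \<omega> * (norm (b - T \<omega>))\<^sup>2 + s \<omega> * (norm (- b - T \<omega>))\<^sup>2
      - 2 * (s \<omega> * (norm (0 - T \<omega>))\<^sup>2)) / 2) = s"
    using b by (intro ext) (simp add: power2_norm_eq_inner algebra_simps inner_commute)
  finally show ?thesis .
qed

lemma integrable_weighted_displacement: "integrable M (\<lambda>\<omega>. s \<omega> *\<^sub>R (x\<^sub>0 - T \<omega>))"
proof (rule integrable_inner_euclideanI)
  fix d
  \<comment> \<open>Polarization: the increment of the loss from \<open>x\<^sub>0\<close> to
    \<open>x\<^sub>0 + d\<close> is the wanted linear term, doubled, plus \<open>s\<close> times the
    squared norm of \<open>d\<close>. The latter is integrable because the weight is.\<close>
  have "integrable M (\<lambda>\<omega>. (s \<omega> * (norm ((x\<^sub>0 + d) - T \<omega>))\<^sup>2 - s \<omega> * (norm (x\<^sub>0 - T \<omega>))\<^sup>2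
      - s \<omega> * (norm d)\<^sup>2) / 2)"
    by (intro integrable_divide Bochner_Integration.integrable_diff
        integrable_mult_left finite_loss integrable_weight)
  also have "(\<lambda>\<omega>. (s \<omega> * (norm ((x\<^sub>0 + d) - T \<omega>))\<^sup>2 - s \<omega> * (norm (x\<^sub>0 - T \<omega>))\<^sup>2
      - s \<omega> * (norm d)\<^sup>2) / 2) = (\<lambda>\<omega>. (s \<omega> *\<^sub>R (x\<^sub>0 - T \<omega>)) \<bullet> d)"
    by (intro ext, subst norm_power2_diff_expand[of "x\<^sub>0 + d" _ "x\<^sub>0"]) (simp add: distrib_left)
  finally show "integrable M (\<lambda>\<omega>. (s \<omega> *\<^sub>R (x\<^sub>0 - T \<omega>)) \<bullet> d)" .
qed

lemma GDERIV_integral_weighted_norm_power2: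
  "GDERIV (\<lambda>x. \<integral>\<omega>. s \<omega> * (norm (x - T \<omega>))\<^sup>2 \<partial>M) x\<^sub>0
    :> 2 *\<^sub>R (\<integral>\<omega>. s \<omega> *\<^sub>R (x\<^sub>0 - T \<omega>) \<partial>M)"
proof -
  let ?S = "\<integral>\<omega>. s \<omega> \<partial>M"
  let ?R = "\<integral>\<omega>. s \<omega> *\<^sub>R (x\<^sub>0 - T \<omega>) \<partial>M"
  let ?C = "\<integral>\<omega>. s \<omega> * (norm (x\<^sub>0 - T \<omega>))\<^sup>2 \<partial>M"
  \<comment> \<open>Expanding about \<open>x\<^sub>0\<close> turns the expected loss into a
    polynomial in \<open>x\<close> whose coefficients are integrals independent of
    \<open>x\<close>.\<close>
  have *: "(\<integral>\<omega>. s \<omega> * (norm (x - T \<omega>))\<^sup>2 \<partial>M)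
      = ?S * (norm (x - x\<^sub>0))\<^sup>2 + 2 * (?R \<bullet> (x - x\<^sub>0)) + ?C" for x
  proof -
    have "(\<integral>\<omega>. s \<omega> * (norm (x - T \<omega>))\<^sup>2 \<partial>M) = (\<integral>\<omega>. s \<omega> * (norm (x - x\<^sub>0))\<^sup>2
        + 2 * ((s \<omega> *\<^sub>R (x\<^sub>0 - T \<omega>)) \<bullet> (x - x\<^sub>0)) + s \<omega> * (norm (x\<^sub>0 - T \<omega>))\<^sup>2 \<partial>M)"
      by (intro Bochner_Integration.integral_cong refl)
        (subst norm_power2_diff_expand[of x _ "x\<^sub>0"], simp add: distrib_left mult.left_commute)
    also have "\<dots> = (\<integral>\<omega>. s \<omega> * (norm (x - x\<^sub>0))\<^sup>2 \<partial>M)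
        + (\<integral>\<omega>. 2 * ((s \<omega> *\<^sub>R (x\<^sub>0 - T \<omega>)) \<bullet> (x - x\<^sub>0)) \<partial>M) + ?C"
      by (intro integral_add3 integrable_mult_left integrable_mult_right integrable_inner_left
          integrable_weight integrable_weighted_displacement finite_loss)
    also have "\<dots> = ?S * (norm (x - x\<^sub>0))\<^sup>2 + 2 * (?R \<bullet> (x - x\<^sub>0)) + ?C"
      using integrable_weighted_displacement by (simp del: inner_scaleR_left)
    finally show ?thesis .
  qed
  \<comment> \<open>At \<open>x\<^sub>0\<close> the squared term is stationary and the constant
    drops out, leaving only the linear coefficient.\<close>
  have "GDERIV (\<lambda>x. ?S * (norm (x - x\<^sub>0))\<^sup>2 + 2 * (?R \<bullet> (x - x\<^sub>0)) + ?C) x\<^sub>0 :> 2 *\<^sub>R ?R"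
    unfolding gderiv_def power2_norm_eq_inner
    by (auto intro!: derivative_eq_intros simp: inner_commute)
  then show ?thesis
    by (simp only: flip: *)
qed

end

text \<open>Ensures that at each point of integration the noise level lies where well-formedness
  bounds \<open>alpha_bar\<close>.\<close>

lemma space_noise_measure: "space (noise_measure D) = space (level_dist D) \<times> UNIV"
  by (simp add: noise_measure_def space_pair_measure std_gaussian_def)

proposition sds_equivalent_l2:
  fixes f :: "'p::euclidean_space \<Rightarrow> 'z::euclidean_space"
    and D :: "('t, 'y, 'z) diffusion_model"
  assumes wf: "diffusion_model_wf D" and f: "f differentiable at \<theta>"
  shows GDERIV_l2_loss_sds_sample_gradient: "t \<in> space (level_dist D) \<Longrightarrow>
      GDERIV (\<lambda>\<theta>'. sds_scale D w t * l2_loss (f \<theta>') (generated D y (f \<theta>) t \<epsilon>)) \<theta>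
        :> sds_sample_gradient D w y f \<theta> t \<epsilon>"
    and sds_gradient_eq_l2_gradient: "sds_gradient D w y f \<theta> = l2_gradient D (sds_scale D w) y f \<theta>"
    and GDERIV_expected_l2_loss: "finite_expected_l2_loss D (sds_scale D w) y (f \<theta>) \<Longrightarrow>
      GDERIV (\<lambda>\<theta>'. expected_l2_loss D (sds_scale D w) y (f \<theta>) (f \<theta>')) \<theta>
        :> sds_gradient D w y f \<theta>"
proof -
  let ?A = "adjoint (frechet_derivative f (at \<theta>))"
  have A: "linear ?A"
    using f by (intro adjoint_linear linear_frechet_derivative)
  have sample: "sds_sample_gradient D w y f \<theta> t \<epsilon>
      = ?A ((2 * sds_scale D w t) *\<^sub>R (f \<theta> - generated D y (f \<theta>) t \<epsilon>))"
    if "t \<in> space (level_dist D)" for t \<epsilon>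
    using wf that f by (auto simp: diffusion_model_wf_def intro!: sds_sample_gradient_eq)
  show "GDERIV (\<lambda>\<theta>'. sds_scale D w t * l2_loss (f \<theta>') (generated D y (f \<theta>) t \<epsilon>)) \<theta>
      :> sds_sample_gradient D w y f \<theta> t \<epsilon>" if "t \<in> space (level_dist D)"
    using GDERIV_l2_loss[OF f] by (simp add: sample[OF that])
  have grad: "gradient (\<lambda>\<theta>'. l2_loss (f \<theta>') z) \<theta> = ?A (2 *\<^sub>R (f \<theta> - z))" for z
    using GDERIV_l2_loss[OF f, of 1 z] by (intro gradient_eqI) simp
  \<comment> \<open>The integrands agree at every point of the space, so the equality also covers
    non-integrable integrands, whose integral defaults to 0 on both sides.\<close>
  show "sds_gradient D w y f \<theta> = l2_gradient D (sds_scale D w) y f \<theta>"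
    unfolding sds_gradient_def l2_gradient_def
    by (intro Bochner_Integration.integral_cong refl)
      (auto simp: space_noise_measure sample grad linear_scale[OF A])
  assume "finite_expected_l2_loss D (sds_scale D w) y (f \<theta>)"
  then have int: "integrable (noise_measure D) (\<lambda>\<omega>. sds_scale D w (fst \<omega>) *
      (norm (x - generated D y (f \<theta>) (fst \<omega>) (snd \<omega>)))\<^sup>2)" for x
    by (simp add: finite_expected_l2_loss_def l2_loss_def case_prod_unfold)
  let ?F = "\<lambda>\<omega>. sds_scale D w (fst \<omega>) *\<^sub>R (f \<theta> - generated D y (f \<theta>) (fst \<omega>) (snd \<omega>))"
  have "sds_gradient D w y f \<theta> = (\<integral>\<omega>. ?A (2 *\<^sub>R ?F \<omega>) \<partial>noise_measure D)"
    unfolding sds_gradient_def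
    by (intro Bochner_Integration.integral_cong refl) (auto simp: space_noise_measure sample)
  \<comment> \<open>A linear map between Euclidean spaces is bounded, hence commutes with the
    integral of an integrable function. Finiteness of the expected loss supplies that
    integrability.\<close>
  also have "\<dots> = ?A (\<integral>\<omega>. 2 *\<^sub>R ?F \<omega> \<partial>noise_measure D)"
    using A integrable_weighted_displacement[OF int]
    by (intro integral_bounded_linear integrable_scaleR_right) (auto simp: linear_conv_bounded_linear)
  also have "\<dots> = ?A (2 *\<^sub>R (\<integral>\<omega>. ?F \<omega> \<partial>noise_measure D))"
    by (simp only: integral_scaleR_right)
  finally show "GDERIV (\<lambda>\<theta>'. expected_l2_loss D (sds_scale D w) y (f \<theta>) (f \<theta>')) \<theta>
      :> sds_gradient D w y f \<theta>"
    using GDERIV_compose_adjoint[OF f GDERIV_integral_weighted_norm_power2[OF int]]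
    by (simp add: expected_l2_loss_def l2_loss_def case_prod_unfold)
qed

theorem proposition1:
  fixes g :: "'p::euclidean_space \<Rightarrow> 'v \<Rightarrow> 'x::euclidean_space"
    and enc :: "'x \<Rightarrow> 'z::euclidean_space"
    and D :: "('t, 'y, 'x) diffusion_model" and w :: "'t \<Rightarrow> real"
    and L :: "('s, 'y, 'z) diffusion_model" and v :: "'s \<Rightarrow> real"
    and y :: 'y and \<pi> :: 'v and \<theta> :: 'p
  assumes "diffusion_model_wf D" and "diffusion_model_wf L"
    and "(\<lambda>\<theta>. g \<theta> \<pi>) differentiable at \<theta>"
    and "enc differentiable at (g \<theta> \<pi>)"
  shows
    "((\<forall>t\<in>space (level_dist D). \<forall>\<epsilon>.
          GDERIV (\<lambda>\<theta>'. sds_scale D w t * l2_loss (g \<theta>' \<pi>) (generated D y (g \<theta> \<pi>) t \<epsilon>)) \<theta>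
            :> sds_sample_gradient D w y (\<lambda>\<theta>. g \<theta> \<pi>) \<theta> t \<epsilon>)
      \<and> sds_gradient D w y (\<lambda>\<theta>. g \<theta> \<pi>) \<theta> = l2_gradient D (sds_scale D w) y (\<lambda>\<theta>. g \<theta> \<pi>) \<theta>
      \<and> (finite_expected_l2_loss D (sds_scale D w) y (g \<theta> \<pi>) \<longrightarrow>
          GDERIV (\<lambda>\<theta>'. expected_l2_loss D (sds_scale D w) y (g \<theta> \<pi>) (g \<theta>' \<pi>)) \<theta>
            :> sds_gradient D w y (\<lambda>\<theta>. g \<theta> \<pi>) \<theta>))
   \<and> ((\<forall>t\<in>space (level_dist L). \<forall>\<epsilon>.
          GDERIV (\<lambda>\<theta>'. sds_scale L v t *
                    l2_loss (enc (g \<theta>' \<pi>)) (generated L y (enc (g \<theta> \<pi>)) t \<epsilon>)) \<theta>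
            :> sds_sample_gradient L v y (\<lambda>\<theta>. enc (g \<theta> \<pi>)) \<theta> t \<epsilon>)
      \<and> sds_gradient L v y (\<lambda>\<theta>. enc (g \<theta> \<pi>)) \<theta>
          = l2_gradient L (sds_scale L v) y (\<lambda>\<theta>. enc (g \<theta> \<pi>)) \<theta>
      \<and> (finite_expected_l2_loss L (sds_scale L v) y (enc (g \<theta> \<pi>)) \<longrightarrow>
          GDERIV (\<lambda>\<theta>'. expected_l2_loss L (sds_scale L v) y (enc (g \<theta> \<pi>)) (enc (g \<theta>' \<pi>))) \<theta>
            :> sds_gradient L v y (\<lambda>\<theta>. enc (g \<theta> \<pi>)) \<theta>))"
proof -
  \<comment> \<open>The latent-space half is the same proposition applied to the encoder composed
    with the renderer, so the adjoint there is that of the composite derivative.\<close>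
  have "(\<lambda>\<theta>. enc (g \<theta> \<pi>)) differentiable at \<theta>"
    using differentiable_chain_at[OF assms(3,4)] by (simp add: o_def)
  then show ?thesis
    using assms(1-3) by (intro conjI ballI allI impI sds_equivalent_l2)
qed

end
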